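(* Fix $\kappa\in(0,1)$. Let $(w_p)_p$ be a sequence of non-negative real weights indexed by the primes with $\sup_p w_p<\infty$, let $W(n):=\sum_{p\mid n}w_p$, and let $N_w(x;t):=\#\mathcal F_w(x;t)$ where $\mathcal F_w(x;t):=\{n\leqslant x:\ W(n)=t\}$. Assume that there exist a scale $\mu(x)>0$ with $\mu(x)\to\infty$ as $x\to\infty$, and constants $x_0(\kappa)\geqslant 3$, $C(\kappa)>0$ such that, writing $r_w:=t/\mu(x)$, uniformly for $x\geqslant x_0(\kappa)$, $t\in\mathbb R$ with $\kappa\leqslant r_w\leqslant 1/\kappa$, and all primes $p\leqslant x$, one has $$N_w\left(\frac xp;\,t\right)\leqslant\frac{C(\kappa)}{p}\,N_w(x;t),\qquad N_w\left(\frac xp;\,t-w_p\right)\leqslant C(\kappa)\,\frac{r_w}{p}\,N_w(x;t).$$ Let $f$ be a real strongly additive function satisfying $$\sum_{p}\frac{\min(1,f(p)^2)}{p}<\infty,\qquad \sum_{p:\,|f(p)|\leqslant 1}\frac{f(p)}{p}\ \text{ converges},\qquad \sum_{p:\,f(p)\neq 0}\frac1p=\infty,$$ and let $\eta_f$ be a tail function for $f$. Then there exists a constant $C_\kappa>0$ such that, uniformly for real $x\geqslant 3$, $t\in\mathbb R$ with $\kappa\leqslant r_w\leqslant 1/\kappa$, and all $R\in[3,x]$, $$\#\{n\in\mathcal F_w(x;t):\ f_R(n)\neq f(n)\}\leqslant C_\kappa\, r_w\,\eta_f(R)\,N_w(x;t).$$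
   Context: Sums indexed by $p$ are over primes, taken in increasing order when only conditionally convergent. The set $\mathcal F_w(x;t)$ is defined for all real $x>0$ and $t\in\mathbb R$, with $n$ ranging over positive integers; the scale $\mu$ is a function defined for $x\geqslant 3$. A real function $f$ on the positive integers is strongly additive if $f(mn)=f(m)+f(n)$ whenever $(m,n)=1$ and $f(p^\nu)=f(p)$ for all primes $p$ and $\nu\geqslant 1$. Tail function: a function $\eta_f$ that is continuous, non-increasing, tends to $0$ as $y\to\infty$, and satisfies, for every $y>1$, $$\Bigl|\sum_{p>y,\ |f(p)|\leqslant 1}\frac{f(p)}{p}\Bigr|\leqslant \eta_f(y),\qquad \sum_{p^\nu>y}\frac{\min\{1,f(p)^2\}}{p^\nu}\leqslant\eta_f(y),$$ where the second sum is over prime powers $p^\nu$ ($\nu\geqslant 1$). Truncation: for $R\geqslant 3$, $f_R$ is the additive function determined on prime powers ($\nu\geqslant1$) by $f_R(p^\nu)=f(p)$ if $p\leqslant R$ or $|f(p)|\leqslant 1$, and $f_R(p^\nu)=0$ if $p>R$ and $|f(p)|>1$. The constant $C_\kappa$ depends only on $\kappa$ and on the constants $x_0(\kappa)$, $C(\kappa)$ of the assumed estimates. *)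

theory Defs
  imports "HOL-Analysis.Analysis" "HOL-Computational_Algebra.Computational_Algebra"
begin

text \<open>
  Arithmetic functions and prime-indexed sequences are functions on \<^typ>\<open>nat\<close>; values at \<open>0\<close>,
  respectively at non-primes, are irrelevant.
\<close>

definition additive :: "(nat \<Rightarrow> real) \<Rightarrow> bool" where
  "additive f \<longleftrightarrow> (\<forall>m n. m > 0 \<longrightarrow> n > 0 \<longrightarrow> coprime m n \<longrightarrow> f (m * n) = f m + f n)"

definition strongly_additive :: "(nat \<Rightarrow> real) \<Rightarrow> bool" where
  "strongly_additive f \<longleftrightarrow> additive f \<and> (\<forall>p \<nu>. prime p \<longrightarrow> \<nu> \<ge> 1 \<longrightarrow> f (p ^ \<nu>) = f p)"

definition weight_sum :: "(nat \<Rightarrow> real) \<Rightarrow> nat \<Rightarrow> real" where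
  "weight_sum w n = (\<Sum>p | prime p \<and> p dvd n. w p)"

definition level_set :: "(nat \<Rightarrow> real) \<Rightarrow> real \<Rightarrow> real \<Rightarrow> nat set" where
  "level_set w x t = {n. n \<ge> 1 \<and> real n \<le> x \<and> weight_sum w n = t}"

definition level_count :: "(nat \<Rightarrow> real) \<Rightarrow> real \<Rightarrow> real \<Rightarrow> nat" where
  "level_count w x t = card (level_set w x t)"

text \<open>
  A possibly only conditionally convergent sum over the primes satisfying \<open>P\<close>, taken in increasing
  order, is the series of the following sequence: the interspersed zeros change neither
  convergence nor the value.
\<close>

definition on_primes :: "(nat \<Rightarrow> bool) \<Rightarrow> (nat \<Rightarrow> real) \<Rightarrow> nat \<Rightarrow> real" where
  "on_primes P a n = (if prime n \<and> P n then a n else 0)"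

text \<open>
  The prime powers \<open>p\<^sup>\<nu>\<close> are indexed by the pairs \<open>(p, \<nu>)\<close>. Both sums below are meaningful under the
  convergence hypotheses on \<open>f\<close> that accompany every use of this notion: the first is a tail of a
  convergent series, the second is dominated by twice the sum of \<open>min 1 (f(p)\<^sup>2) / p\<close> over all primes.
\<close>

definition tail_function :: "(nat \<Rightarrow> real) \<Rightarrow> (real \<Rightarrow> real) \<Rightarrow> bool" where
  "tail_function f \<eta> \<longleftrightarrow>
     continuous_on {1<..} \<eta> \<and> antimono_on {1<..} \<eta> \<and> (\<eta> \<longlongrightarrow> 0) at_top \<and>
     (\<forall>y>1. \<bar>\<Sum>p. on_primes (\<lambda>p. real p > y \<and> \<bar>f p\<bar> \<le> 1) (\<lambda>p. f p / real p) p\<bar> \<le> \<eta> y \<and>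
            (\<Sum>\<^sub>\<infinity>(p, \<nu>) \<in> {(p, \<nu>). prime p \<and> \<nu> \<ge> 1 \<and> real (p ^ \<nu>) > y}.
               min 1 ((f p)\<^sup>2) / real (p ^ \<nu>)) \<le> \<eta> y)"

text \<open>
  An additive function is determined by its values at prime powers, since its value at \<open>n\<close> is the
  sum of its values at the prime powers exactly dividing \<open>n\<close>. The values prescribed for the
  truncation do not depend on the exponent. The lemma \<open>truncation_unique\<close> below
  shows that this is the additive function with the prescribed values.
\<close>

definition truncation :: "(nat \<Rightarrow> real) \<Rightarrow> real \<Rightarrow> nat \<Rightarrow> real" where
  "truncation f R n = (\<Sum>p | prime p \<and> p dvd n. if real p \<le> R \<or> \<bar>f p\<bar> \<le> 1 then f p else 0)"

lemma finite_prime_divisors: "n > 0 \<Longrightarrow> finite {p::nat. prime p \<and> p dvd n}"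
  by (rule finite_subset[of _ "{..n}"]) (auto dest: dvd_imp_le)

lemma additive_truncation: "additive (truncation f R)"
  unfolding additive_def
proof (intro allI impI)
  fix m n :: nat
  assume mn: "m > 0" "n > 0" "coprime m n"
  have "{p. prime p \<and> p dvd m * n} = {p. prime p \<and> p dvd m} \<union> {p. prime p \<and> p dvd n}"
    by (auto simp: prime_dvd_mult_iff)
  moreover have "{p. prime p \<and> p dvd m} \<inter> {p. prime p \<and> p dvd n} = {}"
    using mn(3) by (auto dest: coprime_common_divisor_nat)
  ultimately show "truncation f R (m * n) = truncation f R m + truncation f R n"
    unfolding truncation_def using mn by (simp add: sum.union_disjoint finite_prime_divisors)
qed

lemma truncation_prime_power:
  assumes "prime p" "\<nu> \<ge> 1"
  shows "truncation f R (p ^ \<nu>) = (if real p \<le> R \<or> \<bar>f p\<bar> \<le> 1 then f p else 0)"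
proof -
  have "{q. prime q \<and> q dvd p ^ \<nu>} = {p}"
    using assms by (auto simp: prime_dvd_power_iff primes_dvd_imp_eq dest: prime_dvd_power)
  then show ?thesis by (simp add: truncation_def)
qed

lemma additive_eqI:
  assumes g: "additive g" and h: "additive h"
    and eq: "\<And>p \<nu>. prime p \<Longrightarrow> \<nu> \<ge> 1 \<Longrightarrow> g (p ^ \<nu>) = h (p ^ \<nu>)"
    and "n > 0"
  shows "g n = h n"
  using \<open>n > 0\<close>
proof (induction n rule: less_induct)
  case (less n)
  show ?case
  proof (cases "n = 1")
    case True
    have "g (1 * 1) = g 1 + g 1" "h (1 * 1) = h 1 + h 1"
      using g h unfolding additive_def by (simp_all only: coprime_1_left zero_less_one)
    with True show ?thesis by simp
  next
    case False
    then obtain p where p: "prime p" "p dvd n" using prime_factor_nat by blast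
    define \<nu> where "\<nu> = multiplicity p n"
    have "n \<noteq> 0" "\<not> is_unit p" using less.prems p by auto
    then obtain m where m: "n = p ^ \<nu> * m" "\<not> p dvd m"
      unfolding \<nu>_def by (rule multiplicity_decompose')
    have \<nu>: "\<nu> \<ge> 1"
      using p m by (cases \<nu>) auto
    have "m > 0" using m(1) less.prems by (cases m) auto
    have pw: "p ^ \<nu> > 1"
      using p \<nu> by (intro one_less_power) (auto dest: prime_gt_1_nat)
    have "m < n" using \<open>m > 0\<close> pw unfolding m(1) by simp
    then have "g m = h m" using less.IH \<open>m > 0\<close> by simp
    moreover have cop: "coprime (p ^ \<nu>) m"
      using p m(2) by (simp add: prime_imp_coprime)
    have "p ^ \<nu> > 0" using pw by linarith
    then have "g (p ^ \<nu> * m) = g (p ^ \<nu>) + g m" "h (p ^ \<nu> * m) = h (p ^ \<nu>) + h m"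
      using g h \<open>m > 0\<close> cop unfolding additive_def by blast+
    then have "g n = g (p ^ \<nu>) + g m" "h n = h (p ^ \<nu>) + h m"
      unfolding m(1)[symmetric] .
    ultimately show ?thesis using eq[OF p(1) \<nu>] by simp
  qed
qed

lemma truncation_unique:
  assumes "additive g" "n > 0"
    and "\<And>p \<nu>. prime p \<Longrightarrow> \<nu> \<ge> 1 \<Longrightarrow>
           g (p ^ \<nu>) = (if real p \<le> R \<or> \<bar>f p\<bar> \<le> 1 then f p else 0)"
  shows "g n = truncation f R n"
  by (rule additive_eqI[OF assms(1) additive_truncation _ assms(2)])
    (simp only: assms(3) truncation_prime_power)

end

theory Submission
  imports Defs
begin

text \<open>
  The truncation can differ from \<open>f\<close> at \<open>n\<close> only if \<open>n\<close> is divisible by some prime \<open>p > R\<close> with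
  \<open>\<bar>f p\<bar> > 1\<close>; call such a prime exceptional. A multiple \<open>n = p m\<close> of \<open>p\<close> in the level set of height
  \<open>t\<close> has its cofactor \<open>m \<le> x / p\<close> on the level set of height \<open>t\<close> or \<open>t - w p\<close>, according to whether
  \<open>p\<close> divides \<open>m\<close> (lemma \<open>card_multiples_in_level_set\<close>). With \<open>r = t / \<mu> x\<close>, the assumed estimates
  bound the number of these multiples by \<open>C (1 + r) / p\<close> times the size of the level set, and
  \<open>1 + r \<le> (1 + 1 / \<kappa>) r\<close> because \<open>r \<ge> \<kappa>\<close>. It remains to sum over the exceptional primes: for them
  \<open>min 1 (f(p)\<^sup>2) = 1\<close>, so the terms with \<open>\<nu> = 1\<close> in the prime-power condition on the tail function
  already give \<open>\<Sum> 1 / p \<le> \<eta> R\<close> (lemma \<open>sum_inverse_large_primes_le_tail\<close>).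

  The estimates are available only for \<open>x \<ge> x\<^sub>0\<close>. When \<open>x < x\<^sub>0\<close>, either no exceptional prime is at
  most \<open>x\<close>, and nothing is counted, or there is one, and it forces \<open>\<eta> R \<ge> 1 / x \<ge> 1 / x\<^sub>0\<close>; then
  counting the whole level set is good enough with the constant \<open>x\<^sub>0 / \<kappa>\<close>.
\<close>

lemma additive_weight_sum: "additive (weight_sum w)"
  unfolding additive_def
proof (intro allI impI)
  fix m n :: nat
  assume mn: "m > 0" "n > 0" "coprime m n"
  have "{p. prime p \<and> p dvd m * n} = {p. prime p \<and> p dvd m} \<union> {p. prime p \<and> p dvd n}"
    by (auto simp: prime_dvd_mult_iff)
  moreover have "{p. prime p \<and> p dvd m} \<inter> {p. prime p \<and> p dvd n} = {}"
    using mn(3) coprime_common_divisor not_prime_unit by blast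
  ultimately show "weight_sum w (m * n) = weight_sum w m + weight_sum w n"
    unfolding weight_sum_def using mn by (simp add: sum.union_disjoint finite_prime_divisors)
qed

text \<open>
  A strongly additive function is the weighted count of prime divisors with its own values as
  weights. The truncation has the same form, so the two can be compared prime by prime.
\<close>

lemma strongly_additive_eq_weight_sum:
  assumes "strongly_additive f" "n > 0"
  shows "f n = weight_sum f n"
proof (rule additive_eqI[OF _ additive_weight_sum _ assms(2)])
  show "additive f" using assms(1) by (simp add: strongly_additive_def)
next
  fix p \<nu> :: nat assume p: "prime p" "\<nu> \<ge> 1"
  have "{q. prime q \<and> q dvd p ^ \<nu>} = {p}"
    using p by (auto simp: prime_dvd_power_iff primes_dvd_imp_eq dest: prime_dvd_power)
  then show "f (p ^ \<nu>) = weight_sum f (p ^ \<nu>)"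
    using assms(1) p by (simp add: weight_sum_def strongly_additive_def)
qed

lemma truncation_neq_imp_large_prime_divisor:
  assumes "strongly_additive f" "n > 0" "truncation f R n \<noteq> f n"
  obtains p where "prime p" "p dvd n" "real p > R" "\<bar>f p\<bar> > 1"
proof -
  have "truncation f R n = weight_sum f n"
    if small: "\<And>p. prime p \<Longrightarrow> p dvd n \<Longrightarrow> real p \<le> R \<or> \<bar>f p\<bar> \<le> 1"
    unfolding truncation_def weight_sum_def
    by (rule sum.cong[OF refl]) (simp add: small)
  then show thesis
    using strongly_additive_eq_weight_sum[OF assms(1,2)] assms(3) that by (metis not_le)
qed

lemma weight_sum_prime_mult:
  assumes "prime p" "m > 0"
  shows "weight_sum w (p * m) = (if p dvd m then weight_sum w m else w p + weight_sum w m)"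
proof -
  have "{q. prime q \<and> q dvd p * m} = insert p {q. prime q \<and> q dvd m}"
    using assms(1) by (auto simp: prime_dvd_mult_iff primes_dvd_imp_eq)
  then show ?thesis
    using assms by (simp add: weight_sum_def finite_prime_divisors insert_absorb)
qed

lemma finite_level_set: "finite (level_set w x t)"
  by (rule finite_subset[of _ "{..nat \<lfloor>x\<rfloor>}"]) (auto simp: level_set_def le_nat_floor)

text \<open>
  Prime factors are weighted without multiplicity. Hence removing one factor \<open>p\<close> lowers the weight
  by \<open>w p\<close> exactly when no further factor \<open>p\<close> remains, and both heights occur.
\<close>

lemma card_multiples_in_level_set:
  assumes p: "prime p"
  shows "card {n \<in> level_set w x t. p dvd n}
           \<le> level_count w (x / real p) t + level_count w (x / real p) (t - w p)"
proof -
  let ?A = "level_set w (x / real p) t" and ?B = "level_set w (x / real p) (t - w p)"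
  have p0: "real p > 0" using p prime_gt_0_nat by simp
  have "{n \<in> level_set w x t. p dvd n} \<subseteq> (\<lambda>m. p * m) ` (?A \<union> ?B)"
  proof
    fix n assume "n \<in> {n \<in> level_set w x t. p dvd n}"
    then obtain m where n: "n = p * m" "p * m \<ge> 1" "real (p * m) \<le> x" "weight_sum w (p * m) = t"
      by (auto simp: level_set_def)
    then have "m \<ge> 1" "real m \<le> x / real p"
      using p0 by (auto simp: field_simps)
    then have "m \<in> ?A \<union> ?B"
      using n(4) weight_sum_prime_mult[OF p, of m w] by (auto simp: level_set_def split: if_splits)
    then show "n \<in> (\<lambda>m. p * m) ` (?A \<union> ?B)" using n(1) by blast
  qed
  then have "card {n \<in> level_set w x t. p dvd n} \<le> card (?A \<union> ?B)"
    by (intro surj_card_le) (auto simp: finite_level_set)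
  also have "\<dots> \<le> card ?A + card ?B" by (rule card_Un_le)
  finally show ?thesis by (simp add: level_count_def)
qed

text \<open>
  An unconditional sum over a non-summable family would be \<open>0\<close> by convention, so the second condition
  on a tail function carries information only once summability is known. For fixed \<open>p\<close> the sum over
  \<open>\<nu> \<ge> 1\<close> is geometric with value \<open>a p / (p - 1) \<le> 2 a p / p\<close>, which reduces it to the sum over primes.
\<close>

lemma summable_over_prime_powers:
  fixes a :: "nat \<Rightarrow> real"
  assumes a: "\<And>p. a p \<ge> 0"
    and sm: "summable (on_primes (\<lambda>p. True) (\<lambda>p. a p / real p))"
  shows "(\<lambda>(p, \<nu>). a p / real (p ^ \<nu>)) summable_on ({p. prime p} \<times> {1..})"
proof (rule summable_on_SigmaI)
  fix p :: nat assume "p \<in> {p. prime p}"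
  then have p: "real p \<ge> 2" using prime_ge_2_nat by force
  have "(\<lambda>\<nu>. a p / real p * (1 / real p) ^ \<nu>) sums (a p / real p * (1 / (1 - 1 / real p)))"
    using p by (intro sums_mult geometric_sums) auto
  also have "a p / real p * (1 / (1 - 1 / real p)) = a p / (real p - 1)"
    using p by (simp add: field_simps)
  finally have "((\<lambda>\<nu>. a p / real p * (1 / real p) ^ \<nu>) has_sum (a p / (real p - 1))) UNIV"
    using a[of p] p by (intro sums_nonneg_imp_has_sum) auto
  also have "(\<lambda>\<nu>. a p / real p * (1 / real p) ^ \<nu>) = (\<lambda>\<nu>. a p / real (p ^ \<nu>)) \<circ> Suc"
    by (auto simp: power_divide)
  finally have "((\<lambda>\<nu>. a p / real (p ^ \<nu>)) has_sum (a p / (real p - 1))) (range Suc)"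
    by (simp only: has_sum_reindex[OF inj_Suc])
  moreover have "range Suc = {1..}"
    by (auto simp: image_iff Suc_le_eq gr0_conv_Suc)
  ultimately show "((\<lambda>\<nu>. case (p, \<nu>) of (p, \<nu>) \<Rightarrow> a p / real (p ^ \<nu>))
      has_sum (a p / (real p - 1))) {1..}" by simp
next
  have "on_primes (\<lambda>p. True) (\<lambda>p. a p / real p) summable_on UNIV"
    using sm a by (intro summable_nonneg_imp_summable_on) (auto simp: on_primes_def)
  also have "?this \<longleftrightarrow> (\<lambda>p. a p / real p) summable_on {p. prime p}"
    by (rule summable_on_cong_neutral) (auto simp: on_primes_def)
  finally have "(\<lambda>p. 2 * (a p / real p)) summable_on {p. prime p}"
    by (rule summable_on_cmult_right)
  then show "(\<lambda>p. a p / (real p - 1)) summable_on {p. prime p}"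
  proof (rule summable_on_comparison_test)
    fix p :: nat assume "p \<in> {p. prime p}"
    then have p: "real p \<ge> 2" using prime_ge_2_nat by force
    have "a p / (real p - 1) \<le> a p / (real p / 2)"
      using p a[of p] by (intro divide_left_mono) auto
    then show "a p / (real p - 1) \<le> 2 * (a p / real p)" by (simp add: mult.commute)
    show "0 \<le> a p / (real p - 1)" using p a[of p] by simp
  qed
qed (use a in auto)

text \<open>
  The terms \<open>(p, 1)\<close> with \<open>p \<in> P\<close> have numerator \<open>1\<close> because \<open>\<bar>f p\<bar> > 1\<close>. They form part of the
  nonnegative sum over prime powers that the tail function majorizes.
\<close>

lemma sum_inverse_large_primes_le_tail:
  assumes tail: "tail_function f \<eta>"
    and sm: "summable (on_primes (\<lambda>p. True) (\<lambda>p. min 1 ((f p)\<^sup>2) / real p))"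
    and y: "y > 1" and fin: "finite P"
    and P: "\<And>p. p \<in> P \<Longrightarrow> prime p \<and> real p > y \<and> \<bar>f p\<bar> > 1"
  shows "(\<Sum>p\<in>P. 1 / real p) \<le> \<eta> y"
proof -
  let ?g = "\<lambda>(p, \<nu>). min 1 ((f p)\<^sup>2) / real (p ^ \<nu>)"
  let ?S = "{(p, \<nu>). prime p \<and> \<nu> \<ge> 1 \<and> real (p ^ \<nu>) > y}"
  have "?g summable_on ({p. prime p} \<times> {1..})"
    using sm by (intro summable_over_prime_powers) auto
  then have "?g summable_on ?S"
    by (rule summable_on_subset_banach) auto
  moreover have "(\<lambda>p. (p, 1)) ` P \<subseteq> ?S" using P by auto
  ultimately have "sum ?g ((\<lambda>p. (p, 1)) ` P) \<le> infsum ?g ?S"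
    using fin by (intro finite_sum_le_infsum) auto
  moreover have "sum ?g ((\<lambda>p. (p, 1)) ` P) = (\<Sum>p\<in>P. 1 / real p)"
  proof (subst sum.reindex)
    show "inj_on (\<lambda>p. (p, 1 :: nat)) P" by (auto simp: inj_on_def)
    have "min 1 ((f p)\<^sup>2) = 1" if "p \<in> P" for p
    proof -
      have "1 \<le> \<bar>f p\<bar>" using P[OF that] by simp
      then have "1 \<le> \<bar>f p\<bar>\<^sup>2" by (rule one_le_power)
      then show ?thesis by simp
    qed
    then show "sum (?g \<circ> (\<lambda>p. (p, 1))) P = (\<Sum>p\<in>P. 1 / real p)" by (intro sum.cong) auto
  qed
  moreover have "infsum ?g ?S \<le> \<eta> y" using tail y by (simp add: tail_function_def)
  ultimately show ?thesis by simp
qed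

theorem corollary3p7:
  fixes \<kappa> x\<^sub>0 C :: real
  assumes "0 < \<kappa>" "\<kappa> < 1" "x\<^sub>0 \<ge> 3" "C > 0"
  shows "\<exists>C\<^sub>\<kappa>>0. \<forall>(w :: nat \<Rightarrow> real) (\<mu> :: real \<Rightarrow> real) (f :: nat \<Rightarrow> real) (\<eta> :: real \<Rightarrow> real).
    (\<forall>p. prime p \<longrightarrow> w p \<ge> 0) \<longrightarrow> bdd_above (w ` {p. prime p}) \<longrightarrow>
    (\<forall>x\<ge>3. \<mu> x > 0) \<longrightarrow> filterlim \<mu> at_top at_top \<longrightarrow>
    (\<forall>x\<ge>x\<^sub>0. \<forall>t. \<kappa> \<le> t / \<mu> x \<and> t / \<mu> x \<le> 1 / \<kappa> \<longrightarrow>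
       (\<forall>p. prime p \<and> real p \<le> x \<longrightarrow>
          real (level_count w (x / real p) t) \<le> C / real p * real (level_count w x t) \<and>
          real (level_count w (x / real p) (t - w p))
            \<le> C * ((t / \<mu> x) / real p) * real (level_count w x t))) \<longrightarrow>
    strongly_additive f \<longrightarrow>
    summable (on_primes (\<lambda>p. True) (\<lambda>p. min 1 ((f p)\<^sup>2) / real p)) \<longrightarrow>
    summable (on_primes (\<lambda>p. \<bar>f p\<bar> \<le> 1) (\<lambda>p. f p / real p)) \<longrightarrow>
    \<not> summable (on_primes (\<lambda>p. f p \<noteq> 0) (\<lambda>p. 1 / real p)) \<longrightarrow>
    tail_function f \<eta> \<longrightarrow>
    (\<forall>x\<ge>3. \<forall>t. \<kappa> \<le> t / \<mu> x \<and> t / \<mu> x \<le> 1 / \<kappa> \<longrightarrow>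
       (\<forall>R. 3 \<le> R \<and> R \<le> x \<longrightarrow>
          real (card {n \<in> level_set w x t. truncation f R n \<noteq> f n})
            \<le> C\<^sub>\<kappa> * (t / \<mu> x) * \<eta> R * real (level_count w x t)))"
proof -
  \<comment> \<open>The first entry serves \<open>x \<ge> x\<^sub>0\<close>, the second bounds the whole level set when \<open>x < x\<^sub>0\<close>.\<close>
  define K where "K = max (C * (1 + 1 / \<kappa>)) (x\<^sub>0 / \<kappa>)"
  have K: "C * (1 + 1 / \<kappa>) \<le> K" "x\<^sub>0 / \<kappa> \<le> K" by (simp_all add: K_def)
  have "0 < x\<^sub>0 / \<kappa>" using assms by simp
  with K(2) have "K > 0" by linarith
  have main: "real (card {n \<in> level_set w x t. truncation f R n \<noteq> f n})
      \<le> K * (t / \<mu> x) * \<eta> R * real (level_count w x t)"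
    if est: "\<And>p. x \<ge> x\<^sub>0 \<Longrightarrow> prime p \<Longrightarrow> real p \<le> x \<Longrightarrow>
          real (level_count w (x / real p) t) \<le> C / real p * real (level_count w x t) \<and>
          real (level_count w (x / real p) (t - w p))
            \<le> C * ((t / \<mu> x) / real p) * real (level_count w x t)"
      and sa: "strongly_additive f"
      and sm: "summable (on_primes (\<lambda>p. True) (\<lambda>p. min 1 ((f p)\<^sup>2) / real p))"
      and tail: "tail_function f \<eta>"
      and r: "\<kappa> \<le> t / \<mu> x" and R: "R \<ge> 3"
    for w f :: "nat \<Rightarrow> real" and \<mu> \<eta> :: "real \<Rightarrow> real" and x t R :: real
  proof -
    define r where "r = t / \<mu> x"
    define N where "N = real (level_count w x t)"
    define P where "P = {p. prime p \<and> R < real p \<and> real p \<le> x \<and> \<bar>f p\<bar> > 1}"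
    let ?E = "{n \<in> level_set w x t. truncation f R n \<noteq> f n}"
    have N: "N \<ge> 0" by (simp add: N_def)
    have "\<kappa> \<le> r" using r by (simp add: r_def)
    then have r0: "r > 0" "1 \<le> r / \<kappa>" using \<open>0 < \<kappa>\<close> by auto
    have finP: "finite P"
      by (rule finite_subset[of _ "{..nat \<lfloor>x\<rfloor>}"]) (auto simp: P_def le_nat_floor)
    have tail_le: "(\<Sum>p\<in>P. 1 / real p) \<le> \<eta> R"
      using R by (intro sum_inverse_large_primes_le_tail[OF tail sm _ finP]) (auto simp: P_def)
    have cover: "?E \<subseteq> (\<Union>p\<in>P. {n \<in> level_set w x t. p dvd n})"
    proof
      fix n assume n: "n \<in> ?E"
      then have "n > 0" "real n \<le> x" by (auto simp: level_set_def)
      moreover obtain p where p: "prime p" "p dvd n" "real p > R" "\<bar>f p\<bar> > 1"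
        using truncation_neq_imp_large_prime_divisor[OF sa \<open>n > 0\<close>, of R] n by blast
      ultimately have "real p \<le> x"
        using dvd_imp_le[of p n] by linarith
      then show "n \<in> (\<Union>p\<in>P. {n \<in> level_set w x t. p dvd n})" using p n by (auto simp: P_def)
    qed
    have "real (card ?E) \<le> K * r * \<eta> R * N"
    proof (cases "x \<ge> x\<^sub>0")
      case True
      have "card ?E \<le> card (\<Union>p\<in>P. {n \<in> level_set w x t. p dvd n})"
        using cover finP by (intro card_mono) (auto simp: finite_level_set)
      also have "\<dots> \<le> (\<Sum>p\<in>P. card {n \<in> level_set w x t. p dvd n})"
        by (rule card_UN_le[OF finP])
      finally have "real (card ?E) \<le> real (\<Sum>p\<in>P. card {n \<in> level_set w x t. p dvd n})"
        by (rule of_nat_mono)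
      also have "\<dots> = (\<Sum>p\<in>P. real (card {n \<in> level_set w x t. p dvd n}))"
        by (rule of_nat_sum)
      also have "\<dots> \<le> (\<Sum>p\<in>P. C * (1 + r) * N * (1 / real p))"
      proof (rule sum_mono)
        fix p assume "p \<in> P"
        then have p: "prime p" "real p \<le> x" by (auto simp: P_def)
        have "real (card {n \<in> level_set w x t. p dvd n})
            \<le> real (level_count w (x / real p) t) + real (level_count w (x / real p) (t - w p))"
          using card_multiples_in_level_set[OF p(1), of w x t] by linarith
        also have "\<dots> \<le> C / real p * N + C * (r / real p) * N"
          using est[OF True p] by (simp add: N_def r_def)
        also have "\<dots> = C * (1 + r) * N * (1 / real p)"
          by (simp add: algebra_simps add_divide_distrib)
        finally show "real (card {n \<in> level_set w x t. p dvd n}) \<le> C * (1 + r) * N * (1 / real p)" .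
      qed
      also have "\<dots> = C * (1 + r) * N * (\<Sum>p\<in>P. 1 / real p)"
        by (rule sum_distrib_left[symmetric])
      also have "\<dots> \<le> C * (1 + r) * N * \<eta> R"
        using \<open>C > 0\<close> r0 N by (intro mult_left_mono tail_le) simp
      also have "\<dots> \<le> K * r * N * \<eta> R"
      proof -
        have "C * (1 + r) \<le> C * (r / \<kappa> + r)" using r0 \<open>C > 0\<close> by simp
        also have "\<dots> = C * (1 + 1 / \<kappa>) * r" by (simp add: algebra_simps)
        also have "\<dots> \<le> K * r" using K(1) r0 by (intro mult_right_mono) auto
        finally have "C * (1 + r) \<le> K * r" .
        moreover have "0 \<le> (\<Sum>p\<in>P. 1 / real p)" by (rule sum_nonneg) simp
        then have "0 \<le> \<eta> R" using tail_le by linarith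
        ultimately show ?thesis using N by (intro mult_right_mono)
      qed
      finally show ?thesis by (simp add: mult_ac)
    next
      case False
      show ?thesis
      proof (cases "P = {}")
        case True
        then have "\<eta> R \<ge> 0" using tail_le by simp
        moreover from True cover have "?E = {}" by blast
        ultimately show ?thesis
          using \<open>K > 0\<close> r0 N by (simp only: card.empty) simp
      next
        case nonempty: False
        then obtain p where p: "p \<in> P" by blast
        then have px: "real p > 0" "real p \<le> x\<^sub>0" using R False by (auto simp: P_def)
        then have "1 / x\<^sub>0 \<le> 1 / real p" by (intro divide_left_mono) auto
        also have "\<dots> \<le> (\<Sum>p\<in>P. 1 / real p)" using p finP by (intro member_le_sum) auto
        finally have eta: "1 / x\<^sub>0 \<le> \<eta> R" using tail_le by simp
        have "1 \<le> r / \<kappa>" by (rule r0)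
        also have "\<dots> = (x\<^sub>0 / \<kappa>) * r * (1 / x\<^sub>0)" using \<open>x\<^sub>0 \<ge> 3\<close> by simp
        also have "\<dots> \<le> K * r * \<eta> R"
          using K(2) r0 eta \<open>K > 0\<close> \<open>x\<^sub>0 \<ge> 3\<close> by (intro mult_mono) auto
        finally have "1 * N \<le> K * r * \<eta> R * N" using N by (rule mult_right_mono)
        moreover have "real (card ?E) \<le> N"
          unfolding N_def level_count_def by (auto intro!: card_mono simp: finite_level_set)
        ultimately show ?thesis by simp
      qed
    qed
    then show ?thesis by (simp add: r_def N_def)
  qed
  show ?thesis
    by (intro exI[of _ K] conjI allI impI, rule \<open>K > 0\<close>, rule main) blast+
qed

end
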